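(* Let $p\in\mathbb{C}$ with $\Re(p)>0$, let $\nu\ge 0$ be real, and let $b_1,b_2,b_3,c_1\in\mathbb{C}$ with $\Re(c_1)>\Re(b_1)>0$. Then for all $x,y\in\mathbb{C}$ with $|\arg(1-x)|<\pi$ and $|\arg(1-y)|<\pi$, $$F_{1,p,\nu}(b_1,b_2,b_3;c_1;x,y)=\frac{\Gamma(c_1)}{\Gamma(b_1)\Gamma(c_1-b_1)}\sqrt{\frac{2p}{\pi}}\int_0^1 t^{b_1-\frac32}(1-t)^{c_1-b_1-\frac32}(1-xt)^{-b_2}(1-yt)^{-b_3}K_{\nu+\frac12}\!\left(\frac{p}{t(1-t)}\right)dt,$$ where for $(x,y)$ outside the bidisc $|x|<1,\ |y|<1$ the left-hand side denotes the analytic continuation of the defining double series of $F_{1,p,\nu}$.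
   Context: $K_\alpha$ is the modified Bessel function of the second kind (Macdonald function) of order $\alpha$; all powers and square roots take principal values. $(\lambda)_n=\Gamma(\lambda+n)/\Gamma(\lambda)=\lambda(\lambda+1)\cdots(\lambda+n-1)$, $(\lambda)_0=1$, is the Pochhammer symbol, and $B(\alpha,\beta)=\Gamma(\alpha)\Gamma(\beta)/\Gamma(\alpha+\beta)$ is the classical Beta function. For $\Re(p)>0$, $\nu\ge0$, the extended Beta function is $$B_{p,\nu}(u,v)=\sqrt{\frac{2p}{\pi}}\int_0^1 t^{u-\frac32}(1-t)^{v-\frac32}K_{\nu+\frac12}\!\left(\frac{p}{t(1-t)}\right)dt .$$ The $(p,\nu)$-extended Appell function is defined for $|x|<1$, $|y|<1$ by $$F_{1,p,\nu}(b_1,b_2,b_3;c_1;x,y)=\sum_{m,n=0}^\infty\frac{(b_2)_m(b_3)_n\,B_{p,\nu}(b_1+m+n,c_1-b_1)}{B(b_1,c_1-b_1)}\frac{x^m}{m!}\frac{y^n}{n!}.$$ *)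

theory Defs
  imports "HOL-Analysis.Analysis"
begin

(* The classical integral for the modified Bessel function of the second kind (Macdonald
   function).  It converges for Re z > 0 and every order, which covers all arguments
   p / (t (1 - t)) with Re p > 0 and 0 < t < 1 used below. *)
definition macdonald_K :: "complex \<Rightarrow> complex \<Rightarrow> complex" where
  "macdonald_K \<alpha> z =
     (LINT s:{0<..}|lborel. exp (- z * of_real (cosh s)) * cosh (\<alpha> * of_real s))"

definition ext_Beta :: "complex \<Rightarrow> real \<Rightarrow> complex \<Rightarrow> complex \<Rightarrow> complex" where
  "ext_Beta p \<nu> u v =
     csqrt (2 * p / of_real pi) *
     (LINT t:{0<..<1}|lborel.
        of_real t powr (u - 3/2) * of_real (1 - t) powr (v - 3/2) *
        macdonald_K (of_real \<nu> + 1/2) (p / of_real (t * (1 - t))))"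

definition appell_F1_term ::
  "complex \<Rightarrow> real \<Rightarrow> complex \<Rightarrow> complex \<Rightarrow> complex \<Rightarrow> complex \<Rightarrow> complex \<Rightarrow> complex \<Rightarrow> nat \<times> nat \<Rightarrow> complex"
where
  "appell_F1_term p \<nu> b1 b2 b3 c1 x y = (\<lambda>(m, n).
     pochhammer b2 m * pochhammer b3 n * ext_Beta p \<nu> (b1 + of_nat m + of_nat n) (c1 - b1)
       / Beta b1 (c1 - b1) * (x ^ m / fact m) * (y ^ n / fact n))"

definition appell_F1_series ::
  "complex \<Rightarrow> real \<Rightarrow> complex \<Rightarrow> complex \<Rightarrow> complex \<Rightarrow> complex \<Rightarrow> complex \<Rightarrow> complex \<Rightarrow> complex"
where
  "appell_F1_series p \<nu> b1 b2 b3 c1 x y = (\<Sum>\<^sub>\<infinity>mn. appell_F1_term p \<nu> b1 b2 b3 c1 x y mn)"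

(* Holomorphy in two complex variables, on open sets: the Frechet derivative exists and is
   complex linear. *)
definition holomorphic2_on :: "(complex \<times> complex \<Rightarrow> complex) \<Rightarrow> (complex \<times> complex) set \<Rightarrow> bool" where
  "holomorphic2_on f S \<longleftrightarrow>
     (\<forall>z\<in>S. \<exists>a b. (f has_derivative (\<lambda>(h, k). a * h + b * k)) (at z))"

(* z = 1 is excluded by hand, as the library sets Arg 0 = 0. *)
definition slit_plane :: "complex set" where
  "slit_plane = {z. z \<noteq> 1 \<and> \<bar>Arg (1 - z)\<bar> < pi}"

definition appell_F1_continuation ::
  "complex \<Rightarrow> real \<Rightarrow> complex \<Rightarrow> complex \<Rightarrow> complex \<Rightarrow> complex \<Rightarrow> (complex \<times> complex \<Rightarrow> complex) \<Rightarrow> bool"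
where
  "appell_F1_continuation p \<nu> b1 b2 b3 c1 G \<longleftrightarrow>
     holomorphic2_on G (slit_plane \<times> slit_plane) \<and>
     (\<forall>x y. norm x < 1 \<longrightarrow> norm y < 1 \<longrightarrow> G (x, y) = appell_F1_series p \<nu> b1 b2 b3 c1 x y)"

definition appell_F1 ::
  "complex \<Rightarrow> real \<Rightarrow> complex \<Rightarrow> complex \<Rightarrow> complex \<Rightarrow> complex \<Rightarrow> complex \<Rightarrow> complex \<Rightarrow> complex"
where
  "appell_F1 p \<nu> b1 b2 b3 c1 x y =
     (if norm x < 1 \<and> norm y < 1 then appell_F1_series p \<nu> b1 b2 b3 c1 x y
      else (THE w. \<exists>G. appell_F1_continuation p \<nu> b1 b2 b3 c1 G \<and> G (x, y) = w))"

definition appell_F1_integrand ::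
  "complex \<Rightarrow> real \<Rightarrow> complex \<Rightarrow> complex \<Rightarrow> complex \<Rightarrow> complex \<Rightarrow> complex \<Rightarrow> complex \<Rightarrow> real \<Rightarrow> complex"
where
  "appell_F1_integrand p \<nu> b1 b2 b3 c1 x y t =
     of_real t powr (b1 - 3/2) * of_real (1 - t) powr (c1 - b1 - 3/2) *
     (1 - x * of_real t) powr (- b2) * (1 - y * of_real t) powr (- b3) *
     macdonald_K (of_real \<nu> + 1/2) (p / of_real (t * (1 - t)))"

end

(* The Macdonald function decays like exp(-Re z / 2) on half-planes Re z >= c > 0, so the factor
   K(p / (t (1 - t))) absorbs every endpoint singularity and the weight of the extended Beta
   integral is integrable on (0,1).  On the bidisc, the product of the two binomial series
   converges uniformly in t and may be integrated term by term.  On the product of slit planes,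
   the integral is holomorphic by dominated differentiation, and the continuation is unique by
   the identity theorem applied in one variable at a time. *)
theory Submission
  imports Defs "HOL-Complex_Analysis.Complex_Analysis"
begin

text \<open>The integrand is split into \<open>beta_weight\<close>, which does not see x and y and
  is integrable, and \<open>appell_kernel\<close>, which is bounded uniformly in t over compact sets
  of (x, y). Exchanging the integral with a sum or a derivative thus reduces to an integrable weight
  against a bounded factor. The kernel is bounded because the slit plane is star-shaped about 0: x t
  stays in it for 0 \<le> t \<le> 1, so 1 - x t never meets the branch cut. Differentiating in x or
  y only produces a factor b t and raises one exponent parameter by 1, so derivatives stay in the
  kernel family and inherit its bounds. Outside the bidisc \<open>appell_F1\<close> is a definite
  description, so both existence and uniqueness of the continuation enter the identity.\<close>

definition beta_weight :: "complex \<Rightarrow> real \<Rightarrow> complex \<Rightarrow> complex \<Rightarrow> real \<Rightarrow> complex" where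
  "beta_weight p \<nu> u v t =
     of_real t powr (u - 3/2) * of_real (1 - t) powr (v - 3/2) *
     macdonald_K (of_real \<nu> + 1/2) (p / of_real (t * (1 - t)))"

definition appell_kernel :: "complex \<Rightarrow> complex \<Rightarrow> complex \<times> complex \<Rightarrow> real \<Rightarrow> complex" where
  "appell_kernel b2 b3 z t =
     (1 - fst z * of_real t) powr (- b2) * (1 - snd z * of_real t) powr (- b3)"

lemma ext_Beta_eq_weight:
  "ext_Beta p \<nu> u v = csqrt (2 * p / of_real pi) * (LINT t:{0<..<1}|lborel. beta_weight p \<nu> u v t)"
  by (simp add: ext_Beta_def beta_weight_def)

lemma appell_F1_integrand_eq_weight:
  "appell_F1_integrand p \<nu> b1 b2 b3 c1 x y =
     (\<lambda>t. beta_weight p \<nu> b1 (c1 - b1) t * appell_kernel b2 b3 (x, y) t)"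
  by (simp add: fun_eq_iff appell_F1_integrand_def beta_weight_def appell_kernel_def)

section \<open>Decay of the Macdonald function\<close>

lemma set_integrable_exp_minus_Ioi: "set_integrable lborel {0<..} (\<lambda>s::real. exp (- s))"
proof -
  have "(\<lambda>s::real. exp (-1 * s)) absolutely_integrable_on {0..}"
    by (intro nonnegative_absolutely_integrable_1 integrable_on_exp_minus_to_infinity) auto
  then have "set_integrable lborel {0..} (\<lambda>s::real. exp (- s))"
    unfolding set_integrable_def by (subst (asm) integrable_completion) auto
  then show ?thesis
    by (rule set_integrable_subset) auto
qed

text \<open>A quadratic lower bound suffices: it turns \<open>exp (- c * cosh s)\<close> into a
  Gaussian, which beats the factor \<open>exp (norm \<alpha> * s)\<close> coming from the
  order.\<close>

lemma cosh_ge_quadratic: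
  fixes s :: real
  assumes "s \<ge> 0"
  shows "cosh s \<ge> s\<^sup>2 / 4"
proof -
  have "1 + s + s\<^sup>2 / 2 \<le> exp s"
    using exp_lower_Taylor_quadratic[OF assms] .
  moreover have "cosh s \<ge> exp s / 2"
    by (simp add: cosh_field_def)
  ultimately show ?thesis
    using assms by simp
qed

lemma norm_cosh_le:
  fixes w :: complex
  shows "norm (cosh w) \<le> exp (norm w)"
proof -
  have "norm (exp w + exp (- w)) \<le> exp (norm w) + exp (norm w)"
    using norm_triangle_ineq[of "exp w" "exp (- w)"] norm_exp[of w] norm_exp[of "-w"]
    unfolding norm_minus_cancel by linarith
  then show ?thesis
    by (simp add: cosh_field_def norm_divide)
qed

lemma macdonald_majorant_integrable:
  fixes c :: real and \<alpha> :: complex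
  assumes "c > 0"
  shows "set_integrable lborel {0<..} (\<lambda>s. exp (- c * cosh s) * norm (cosh (\<alpha> * of_real s)))"
proof (rule set_integrable_bound)
  \<comment> \<open>Completing the square in \<open>c * s^2 / 4 - (norm \<alpha> + 1) * s\<close>
    leaves exactly the constant -B; the extra 1 is what keeps a factor \<open>exp (- s)\<close> for
    integrability.\<close>
  define B where "B = (norm \<alpha> + 1)\<^sup>2 / c"
  show "set_integrable lborel {0<..} (\<lambda>s::real. exp B * exp (- s))"
    using set_integrable_exp_minus_Ioi by simp
  show "set_borel_measurable lborel {0<..} (\<lambda>s. exp (- c * cosh s) * norm (cosh (\<alpha> * of_real s)))"
    unfolding set_borel_measurable_def cosh_def by measurable
  have "exp (- c * cosh s) * norm (cosh (\<alpha> * of_real s)) \<le> exp B * exp (- s)" if "s > 0" for s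
  proof -
    have "exp (- c * cosh s) * norm (cosh (\<alpha> * of_real s))
        \<le> exp (- c * (s\<^sup>2 / 4)) * exp (norm \<alpha> * s)"
      using cosh_ge_quadratic[of s] that assms norm_cosh_le[of "\<alpha> * of_real s"]
      by (intro mult_mono) (auto simp: norm_mult)
    also have "\<dots> = exp (norm \<alpha> * s - c * (s\<^sup>2 / 4))"
      by (simp add: exp_add[symmetric])
    also have "\<dots> \<le> exp (B - s)"
    proof -
      have "0 \<le> (c * s / 2 - (norm \<alpha> + 1))\<^sup>2 / c"
        using assms by simp
      also have "\<dots> = c * (s\<^sup>2 / 4) - (norm \<alpha> + 1) * s + B"
        using assms by (simp add: B_def power2_eq_square field_simps)
      finally show ?thesis by (simp add: algebra_simps)
    qed
    finally show ?thesis by (simp add: exp_diff exp_minus field_simps)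
  qed
  then show "AE s in lborel. s \<in> {0<..} \<longrightarrow>
      norm (exp (- c * cosh s) * norm (cosh (\<alpha> * of_real s))) \<le> norm (exp B * exp (- s))"
    by auto
qed

text \<open>Half of \<open>Re z * cosh s\<close> is at least \<open>Re z / 2\<close> since cosh s
  \<ge> 1; the other half is at least \<open>(c / 2) * cosh s\<close> and dominates the integral.
  The constant is the integral of this majorant, hence independent of z.\<close>

lemma norm_macdonald_K_le:
  fixes c :: real and \<alpha> :: complex
  assumes "c > 0"
  obtains C where "C \<ge> 0" "\<And>z. Re z \<ge> c \<Longrightarrow> norm (macdonald_K \<alpha> z) \<le> C * exp (- Re z / 2)"
proof
  define g where "g s = exp (- (c / 2) * cosh s) * norm (cosh (\<alpha> * of_real s))" for s
  have g: "set_integrable lborel {0<..} g"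
    unfolding g_def by (rule macdonald_majorant_integrable) (use assms in auto)
  show "(LINT s:{0<..}|lborel. g s) \<ge> 0"
    unfolding set_lebesgue_integral_def g_def by (intro integral_nonneg_AE) auto
  fix z :: complex assume z: "Re z \<ge> c"
  define f where "f s = exp (- z * of_real (cosh s)) * cosh (\<alpha> * of_real s)" for s
  have le: "norm (f s) \<le> exp (- Re z / 2) * g s" for s
  proof -
    have "Re z / 2 + (c / 2) * cosh s \<le> Re z * cosh s"
    proof -
      have "Re z * 1 \<le> Re z * cosh s" "c * cosh s \<le> Re z * cosh s"
        using z assms cosh_real_ge_1[of s] by (intro mult_left_mono mult_right_mono; simp)+
      then have "Re z + c * cosh s \<le> 2 * (Re z * cosh s)" by linarith
      then show ?thesis by (simp add: field_simps)
    qed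
    then have "norm (exp (- z * of_real (cosh s))) \<le> exp (- Re z / 2) * exp (- (c / 2) * cosh s)"
      by (simp add: exp_add[symmetric])
    then show ?thesis
      unfolding f_def g_def norm_mult by (simp add: mult_right_mono mult.assoc[symmetric])
  qed
  have int_g: "set_integrable lborel {0<..} (\<lambda>s. exp (- Re z / 2) * g s)"
    using g by simp
  have int_f: "set_integrable lborel {0<..} f"
  proof (rule set_integrable_bound[OF int_g])
    show "set_borel_measurable lborel {0<..} f"
      unfolding set_borel_measurable_def f_def cosh_def by measurable
    show "AE s in lborel. s \<in> {0<..} \<longrightarrow> norm (f s) \<le> norm (exp (- Re z / 2) * g s)"
      using le by (auto intro!: AE_I2 order_trans[OF _ abs_ge_self])
  qed
  have "norm (macdonald_K \<alpha> z) \<le> (LINT s:{0<..}|lborel. exp (- Re z / 2) * g s)"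
    unfolding macdonald_K_def f_def[symmetric] set_lebesgue_integral_def
    by (rule Bochner_Integration.integral_norm_bound_integral)
       (use int_f int_g le in \<open>auto simp: set_integrable_def indicator_def\<close>)
  then show "norm (macdonald_K \<alpha> z) \<le> (LINT s:{0<..}|lborel. g s) * exp (- Re z / 2)"
    by (simp add: mult.commute)
qed

section \<open>Absorption of the endpoint powers and integrability of the extended Beta
  weight\<close>

lemma macdonald_K_measurable [measurable]: "macdonald_K \<alpha> \<in> borel_measurable borel"
  unfolding macdonald_K_def set_lebesgue_integral_def cosh_def by measurable

text \<open>After taking logarithms the claim is that c / t outgrows |a| (- ln t) as t tends to 0,
  which follows from ln u \<le> u - 1 at u = \<epsilon> / t.\<close>

lemma powr_times_exp_minus_inverse_bounded:
  fixes a c :: real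
  assumes "c > 0"
  obtains C where "C \<ge> 0" "\<And>t. 0 < t \<Longrightarrow> t \<le> 1 \<Longrightarrow> t powr a * exp (- c / t) \<le> C"
proof
  \<comment> \<open>Chosen so that |a| \<epsilon> \<le> c; the added 1 keeps the denominator
    positive when a = 0.\<close>
  define \<epsilon> where "\<epsilon> = c / (\<bar>a\<bar> + 1)"
  have \<epsilon>: "\<epsilon> > 0" "\<bar>a\<bar> * \<epsilon> \<le> c"
    using assms by (auto simp: \<epsilon>_def field_simps)
  show "exp (- \<bar>a\<bar> * ln \<epsilon>) \<ge> 0" by simp
  fix t :: real assume t: "0 < t" "t \<le> 1"
  have "a * ln t \<le> \<bar>a\<bar> * (- ln t)"
    using t abs_ge_self[of "a * ln t"] by (simp add: abs_mult)
  also have "- ln t \<le> \<epsilon> / t - ln \<epsilon>"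
    using ln_le_minus_one[of "\<epsilon> / t"] t \<epsilon> by (simp add: ln_div)
  then have "\<bar>a\<bar> * (- ln t) \<le> \<bar>a\<bar> * (\<epsilon> / t - ln \<epsilon>)"
    by (rule mult_left_mono) auto
  also have "\<dots> \<le> c / t - \<bar>a\<bar> * ln \<epsilon>"
    using \<epsilon> t by (simp add: right_diff_distrib divide_right_mono)
  finally have "a * ln t - c / t \<le> - \<bar>a\<bar> * ln \<epsilon>" by simp
  then show "t powr a * exp (- c / t) \<le> exp (- \<bar>a\<bar> * ln \<epsilon>)"
    using t by (simp add: powr_def exp_add[symmetric])
qed

lemma set_integrable_bounded_Ioo:
  fixes f :: "real \<Rightarrow> complex"
  assumes "set_borel_measurable lborel {0<..<1} f" "\<And>t. 0 < t \<Longrightarrow> t < 1 \<Longrightarrow> norm (f t) \<le> C"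
  shows "set_integrable lborel {0<..<1} f"
proof (rule set_integrable_bound[where f = "\<lambda>_. C"])
  show "set_integrable lborel {0<..<1::real} (\<lambda>_. C)"
    unfolding set_integrable_def by (intro integrable_real_mult_indicator integrable_scaleR_left) auto
  show "AE t in lborel. t \<in> {0<..<1} \<longrightarrow> norm (f t) \<le> norm C"
    using assms(2) by (auto intro!: AE_I2 order_trans[OF _ abs_ge_self])
qed (use assms in auto)

lemma beta_weight_measurable [measurable]: "beta_weight p \<nu> u v \<in> borel_measurable borel"
  unfolding beta_weight_def powr_def by measurable

text \<open>By 1 / (t (1 - t)) = 1 / t + 1 / (1 - t), the decay of the Macdonald factor splits into
  one exponential per endpoint. Each bounds the power at its own end, whatever the exponent, so the
  weight is bounded on (0,1).\<close>

lemma beta_weight_integrable: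
  assumes "Re p > 0"
  shows "set_integrable lborel {0<..<1} (beta_weight p \<nu> u v)"
proof -
  define \<alpha> where "\<alpha> = complex_of_real \<nu> + 1/2"
  define c where "c = Re p / 2"
  have "c > 0" using assms by (simp add: c_def)
  obtain K where K: "K \<ge> 0" "\<And>z. Re z \<ge> Re p \<Longrightarrow> norm (macdonald_K \<alpha> z) \<le> K * exp (- Re z / 2)"
    using norm_macdonald_K_le[OF assms] by blast
  obtain C1 where C1: "C1 \<ge> 0" "\<And>t. 0 < t \<Longrightarrow> t \<le> 1 \<Longrightarrow> t powr (Re u - 3/2) * exp (- c / t) \<le> C1"
    using powr_times_exp_minus_inverse_bounded[OF \<open>c > 0\<close>] by blast
  obtain C2 where C2: "C2 \<ge> 0" "\<And>t. 0 < t \<Longrightarrow> t \<le> 1 \<Longrightarrow> t powr (Re v - 3/2) * exp (- c / t) \<le> C2"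
    using powr_times_exp_minus_inverse_bounded[OF \<open>c > 0\<close>] by blast
  show ?thesis
  proof (rule set_integrable_bounded_Ioo)
    show "set_borel_measurable lborel {0<..<1} (beta_weight p \<nu> u v)"
      unfolding set_borel_measurable_def by measurable
    fix t :: real assume t: "0 < t" "t < 1"
    have Re: "Re (p / of_real (t * (1 - t))) = Re p / (t * (1 - t))"
      by (metis Re_divide_of_real)
    have split: "exp (- (Re p / (t * (1 - t))) / 2) = exp (- c / t) * exp (- c / (1 - t))"
      using t by (simp add: exp_add[symmetric] c_def field_simps)
    \<comment> \<open>This keeps the real part of the argument at least \<open>Re p\<close>, where
      the decay estimate K is available.\<close>
    have "t * (1 - t) \<le> 1" using t by (simp add: mult_le_one)
    then have "Re p \<le> Re p / (t * (1 - t))"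
      using t assms mult_left_mono[of "t * (1 - t)" 1 "Re p"] by (simp add: pos_le_divide_eq del: mult_1_right)
    then have "norm (macdonald_K \<alpha> (p / of_real (t * (1 - t))))
        \<le> K * (exp (- c / t) * exp (- c / (1 - t)))"
      using K(2)[of "p / of_real (t * (1 - t))"] unfolding Re split by simp
    moreover have "norm (complex_of_real t powr (u - 3/2)) = t powr (Re u - 3/2)"
      "norm (complex_of_real (1 - t) powr (v - 3/2)) = (1 - t) powr (Re v - 3/2)"
      using t by (subst norm_powr_real_powr; simp)+
    ultimately have "norm (beta_weight p \<nu> u v t)
        \<le> t powr (Re u - 3/2) * (1 - t) powr (Re v - 3/2) * (K * (exp (- c / t) * exp (- c / (1 - t))))"
      unfolding beta_weight_def norm_mult \<alpha>_def by (simp add: mult_left_mono)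
    also have "\<dots> = K * ((t powr (Re u - 3/2) * exp (- c / t)) * ((1 - t) powr (Re v - 3/2) * exp (- c / (1 - t))))"
      by (simp add: mult_ac)
    also have "\<dots> \<le> K * (C1 * C2)"
      using C1(2)[of t] C2(2)[of "1 - t"] t K(1) C1(1)
      by (intro mult_left_mono mult_mono) auto
    finally show "norm (beta_weight p \<nu> u v t) \<le> K * (C1 * C2)" .
  qed
qed

section \<open>The slit plane and the Appell kernel\<close>

text \<open>\<open>Arg\<close> equals pi exactly on the negative reals, and the excluded point z = 1
  supplies the missing origin of the closed cut.\<close>

lemma slit_plane_iff: "z \<in> slit_plane \<longleftrightarrow> 1 - z \<notin> \<real>\<^sub>\<le>\<^sub>0"
proof -
  have "\<bar>Arg (1 - z)\<bar> < pi \<longleftrightarrow> Arg (1 - z) \<noteq> pi"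
    using Arg_bounded[of "1 - z"] by auto
  then show ?thesis
    by (auto simp: slit_plane_def Arg_eq_pi complex_nonpos_Reals_iff complex_eq_iff)
qed

text \<open>If 1 - x t were a nonpositive real, then t > 0 and x would be real; but a real x in the
  slit plane is below 1, so x t < 1.\<close>

lemma slit_plane_segment:
  assumes "x \<in> slit_plane" "0 \<le> t" "t \<le> 1"
  shows "1 - x * of_real t \<notin> \<real>\<^sub>\<le>\<^sub>0"
proof
  assume "1 - x * of_real t \<in> \<real>\<^sub>\<le>\<^sub>0"
  then have *: "Re x * t \<ge> 1" "Im x = 0 \<or> t = 0"
    by (auto simp: complex_nonpos_Reals_iff)
  then have "t \<noteq> 0" by auto
  with * have "Im x = 0" by auto
  then have "Re x < 1"
    using assms(1) by (auto simp: slit_plane_iff complex_nonpos_Reals_iff)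
  then have "Re x * t < 1"
    using assms(2,3) \<open>t \<noteq> 0\<close> mult_strict_right_mono[of "Re x" 1 t] by linarith
  with * show False by simp
qed

lemma open_slit_plane: "open slit_plane"
proof -
  have "slit_plane = (\<lambda>z. 1 - z) -` (- \<real>\<^sub>\<le>\<^sub>0)"
    by (auto simp: slit_plane_iff)
  moreover have "open \<dots>"
    by (intro open_vimage) (auto intro!: continuous_intros)
  ultimately show ?thesis by simp
qed

lemma ball_subset_slit_plane: "norm x < 1 \<Longrightarrow> x \<in> slit_plane"
  using complex_Re_le_cmod[of x] by (auto simp: slit_plane_iff complex_nonpos_Reals_iff)

lemma connected_slit_plane: "connected slit_plane"
proof (rule starlike_imp_connected)
  have "closed_segment 0 x \<subseteq> slit_plane" if "x \<in> slit_plane" for x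
    using slit_plane_segment[OF that]
    by (auto simp: closed_segment_def slit_plane_iff scaleR_conv_of_real mult.commute)
  moreover have "0 \<in> slit_plane" by (simp add: ball_subset_slit_plane)
  ultimately show "starlike slit_plane"
    unfolding starlike_def by (intro bexI[of _ 0] ballI)
qed

section \<open>Uniform bounds for the kernel\<close>

lemma continuous_on_powr_slit:
  assumes "continuous_on S f" "continuous_on S g" "\<And>s. s \<in> S \<Longrightarrow> f s \<in> slit_plane"
    "\<And>s. s \<in> S \<Longrightarrow> 0 \<le> g s \<and> g s \<le> 1"
  shows "continuous_on S (\<lambda>s. (1 - f s * complex_of_real (g s)) powr a)"
proof -
  have "1 - f s * complex_of_real (g s) \<notin> \<real>\<^sub>\<le>\<^sub>0" if "s \<in> S" for s
    by (rule slit_plane_segment) (use assms that in auto)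
  \<comment> \<open>Continuity of the complex power needs two facts: the base avoids the open
    negative axis, and it is nonzero, because the exponent a may have nonpositive real part.\<close>
  then have "Re (1 - f s * complex_of_real (g s)) \<ge> 0 \<or> Im (1 - f s * complex_of_real (g s)) \<noteq> 0"
    "1 - f s * complex_of_real (g s) \<noteq> 0" if "s \<in> S" for s
    using that by (fastforce simp: complex_nonpos_Reals_iff simp del: minus_complex.sel)+
  then show ?thesis
    by (intro continuous_on_powr_complex continuous_intros assms(1,2)) auto
qed

text \<open>Joint continuity in (z, t) on the compact set K \<times> [0,1] gives one bound for all
  t; the closed interval is taken for compactness although the integrals run over (0,1).\<close>

lemma appell_kernel_bounded:
  assumes "compact K" "K \<subseteq> slit_plane \<times> slit_plane"
  obtains C where "C \<ge> 0"
    "\<And>z t. z \<in> K \<Longrightarrow> 0 \<le> t \<Longrightarrow> t \<le> 1 \<Longrightarrow> norm (appell_kernel b2 b3 z t) \<le> C"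
proof -
  have "continuous_on (K \<times> {0..1}) (\<lambda>s. appell_kernel b2 b3 (fst s) (snd s))"
    unfolding appell_kernel_def
    by (intro continuous_on_mult continuous_on_powr_slit continuous_intros)
       (use assms(2) in \<open>auto simp: mem_Times_iff\<close>)
  then have "bounded ((\<lambda>s. appell_kernel b2 b3 (fst s) (snd s)) ` (K \<times> {0..1}))"
    by (intro compact_imp_bounded compact_continuous_image compact_Times assms(1)) auto
  then obtain C where "C > 0" "\<forall>s\<in>K \<times> {0..1}. norm (appell_kernel b2 b3 (fst s) (snd s)) \<le> C"
    unfolding bounded_pos by auto
  then show ?thesis
    by (intro that[of C]) auto
qed

lemma appell_kernel_measurable [measurable]: "appell_kernel b2 b3 z \<in> borel_measurable borel"
  unfolding appell_kernel_def powr_def by measurable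

lemma set_integrable_mult_bounded:
  fixes w f :: "real \<Rightarrow> complex"
  assumes "set_integrable lborel A w" "f \<in> borel_measurable borel"
    "\<And>t. t \<in> A \<Longrightarrow> norm (f t) \<le> C"
  shows "set_integrable lborel A (\<lambda>t. w t * f t)"
proof (rule set_integrable_bound)
  show "set_integrable lborel A (\<lambda>t. w t * of_real C)"
    using assms(1) by simp
  \<comment> \<open>Integrability on A makes w measurable only after multiplication by the
    indicator, so the indicator stays attached to w.\<close>
  have "(\<lambda>t. (indicator A t *\<^sub>R w t) * f t) \<in> borel_measurable lborel"
    using borel_measurable_integrable[OF assms(1)[unfolded set_integrable_def]] assms(2)
    by (intro borel_measurable_times) auto
  then show "set_borel_measurable lborel A (\<lambda>t. w t * f t)"
    by (simp add: set_borel_measurable_def)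
  show "AE t in lborel. t \<in> A \<longrightarrow> norm (w t * f t) \<le> norm (w t * of_real C)"
    using assms(3) by (auto simp: norm_mult intro!: AE_I2 mult_left_mono intro: order_trans[OF _ abs_ge_self])
qed

lemma weighted_appell_kernel_integrable:
  assumes "set_integrable lborel {0<..<1} w" "z \<in> slit_plane \<times> slit_plane"
  shows "set_integrable lborel {0<..<1} (\<lambda>t. w t * appell_kernel b2 b3 z t)"
proof -
  obtain C where "\<And>y t. y \<in> {z} \<Longrightarrow> 0 \<le> t \<Longrightarrow> t \<le> 1 \<Longrightarrow> norm (appell_kernel b2 b3 y t) \<le> C"
    by (rule appell_kernel_bounded[of "{z}" b2 b3]) (use assms(2) in auto)
  then show ?thesis
    by (intro set_integrable_mult_bounded[OF assms(1) appell_kernel_measurable, where C = C]) auto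
qed

section \<open>Termwise integration of the double series\<close>

text \<open>The sign in (-a choose n) = (-1)^n (a)_n / n! cancels that of (-z)^n, turning the
  binomial series at -z into its Pochhammer form.\<close>

lemma gbinomial_minus_mult_power:
  fixes a z :: "'a :: field_char_0"
  shows "((- a) gchoose n) * (- z) ^ n = pochhammer a n / fact n * z ^ n"
proof -
  have "(- 1 :: 'a) ^ n * (- z) ^ n = z ^ n"
    by (subst power_mult_distrib[symmetric]) simp
  then show ?thesis
    by (simp add: gbinomial_pochhammer)
qed

lemma binomial_series_norm_summable:
  fixes a z :: complex
  assumes "norm z < 1"
  shows "summable (\<lambda>n. norm (pochhammer a n / fact n * z ^ n))"
proof -
  \<comment> \<open>A power series that converges at r converges absolutely at every point of
    smaller modulus.\<close>
  obtain r where r: "norm z < r" "r < 1"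
    using dense[OF assms] by auto
  then have "0 \<le> r" using norm_ge_zero[of z] by linarith
  have "summable (\<lambda>n. ((- a) gchoose n) * (of_real (- r)) ^ n)"
    using gen_binomial_complex[of "of_real (- r)" "- a"] r \<open>0 \<le> r\<close> by (auto simp: sums_iff)
  then have "summable (\<lambda>n. pochhammer a n / fact n * (of_real r) ^ n)"
    by (simp add: gbinomial_minus_mult_power)
  then show ?thesis
    by (rule powser_insidea) (use r \<open>0 \<le> r\<close> in auto)
qed

lemma binomial_series_has_sum:
  fixes a z :: complex
  assumes "norm z < 1"
  shows "((\<lambda>n. pochhammer a n / fact n * z ^ n) has_sum (1 - z) powr (- a)) UNIV"
proof (rule norm_summable_imp_has_sum[OF binomial_series_norm_summable[OF assms]])
  have "(\<lambda>n. ((- a) gchoose n) * (- z) ^ n) sums (1 + (- z)) powr (- a)"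
    by (rule gen_binomial_complex) (use assms in auto)
  then show "(\<lambda>n. pochhammer a n / fact n * z ^ n) sums (1 - z) powr (- a)"
    by (simp add: gbinomial_minus_mult_power)
qed

text \<open>Absolute summability of both factors makes the double family unconditionally summable,
  so it may be summed row by row. The second conclusion supplies the majorant for the
  M-test.\<close>

lemma has_sum_product_nat:
  fixes f g :: "nat \<Rightarrow> complex"
  assumes "(f has_sum a) UNIV" "(g has_sum b) UNIV"
    "summable (\<lambda>n. norm (f n))" "summable (\<lambda>n. norm (g n))"
  shows "((\<lambda>(m, n). f m * g n) has_sum (a * b)) UNIV"
    and "(\<lambda>(m, n). norm (f m) * norm (g n)) summable_on UNIV"
proof -
  have f: "(\<lambda>n. norm (f n)) summable_on UNIV" and g: "(\<lambda>n. norm (g n)) summable_on UNIV"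
    using assms(3,4) by (auto intro: summable_nonneg_imp_summable_on norm_summable_imp_summable_on)
  have "(\<lambda>x. norm ((\<lambda>(m, n). norm (f m) * norm (g n)) x)) summable_on Sigma UNIV (\<lambda>_. UNIV)"
    unfolding Infinite_Sum.abs_summable_on_Sigma_iff
    using f g by (simp add: infsum_cmult_right' abs_mult infsum_nonneg summable_on_cmult_right summable_on_cmult_left)
  then show *: "(\<lambda>(m, n). norm (f m) * norm (g n)) summable_on UNIV"
    by (simp add: case_prod_unfold abs_mult)
  have "(\<lambda>(m, n). f m * g n) summable_on UNIV"
    by (rule abs_summable_summable) (use * in \<open>simp add: case_prod_unfold norm_mult\<close>)
  then show "((\<lambda>(m, n). f m * g n) has_sum (a * b)) UNIV"
    using has_sum_SigmaI[where f = "\<lambda>(m, n). f m * g n" and g = "\<lambda>m. f m * b"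
        and A = UNIV and B = "\<lambda>_. UNIV" and S = "a * b"]
      assms(1,2) by (simp add: has_sum_cmult_right has_sum_cmult_left)
qed

text \<open>Unordered sums are limits along the filter of finite subsets, which is not a sequence.
  Uniform convergence from the M-test is available along that filter and, against an integrable
  weight, lets the limit pass under the integral.\<close>

lemma has_sum_weighted_integral:
  fixes w :: "real \<Rightarrow> complex" and f :: "'i \<Rightarrow> real \<Rightarrow> complex"
  assumes w: "set_integrable lborel A w"
    and meas: "\<And>i. f i \<in> borel_measurable borel"
    and le: "\<And>i t. i \<in> I \<Longrightarrow> t \<in> A \<Longrightarrow> norm (f i t) \<le> M i"
    and M: "M summable_on I"
    and S: "\<And>t. t \<in> A \<Longrightarrow> ((\<lambda>i. f i t) has_sum S t) I"
    and int_S: "set_integrable lborel A (\<lambda>t. w t * S t)"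
  shows "((\<lambda>i. LINT t:A|lborel. w t * f i t) has_sum (LINT t:A|lborel. w t * S t)) I"
  unfolding has_sum_def
proof (rule tendstoI)
  fix e :: real assume "e > 0"
  define J where "J = (LINT t:A|lborel. norm (w t))"
  have int_w: "set_integrable lborel A (\<lambda>t. norm (w t))"
    using set_integrable_norm[OF w] .
  have "J \<ge> 0"
    unfolding J_def set_lebesgue_integral_def by (intro integral_nonneg_AE) auto
  \<comment> \<open>J may vanish; dividing by J + 1 still gives the strict inequality J d <
    e.\<close>
  define d where "d = e / (J + 1)"
  have d: "d > 0" "J * d < e"
    using \<open>e > 0\<close> \<open>J \<ge> 0\<close> by (auto simp: d_def field_simps)
  have "uniform_limit A (\<lambda>F t. \<Sum>i\<in>F. f i t) S (finite_subsets_at_top I)"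
    using le S M by (rule Weierstrass_m_test_general')
  then have "\<forall>\<^sub>F F in finite_subsets_at_top I. \<forall>t\<in>A. dist (\<Sum>i\<in>F. f i t) (S t) < d"
    using d(1) by (rule uniform_limitD)
  moreover have "\<forall>\<^sub>F F in finite_subsets_at_top I. finite F \<and> F \<subseteq> I"
    by (rule eventually_finite_subsets_at_top_weakI) auto
  ultimately show "\<forall>\<^sub>F F in finite_subsets_at_top I.
      dist (\<Sum>i\<in>F. LINT t:A|lborel. w t * f i t) (LINT t:A|lborel. w t * S t) < e"
  proof eventually_elim
    case (elim F)
    have int: "set_integrable lborel A (\<lambda>t. w t * f i t)" if "i \<in> F" for i
      using that elim(2) by (intro set_integrable_mult_bounded[OF w meas le]) auto
    have sum: "(\<Sum>i\<in>F. LINT t:A|lborel. w t * f i t) = (LINT t:A|lborel. \<Sum>i\<in>F. w t * f i t)"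
      using int unfolding set_lebesgue_integral_def set_integrable_def scaleR_sum_right
      by (intro Bochner_Integration.integral_sum[symmetric]) auto
    have int_sum: "set_integrable lborel A (\<lambda>t. \<Sum>i\<in>F. w t * f i t)"
      using int unfolding set_integrable_def scaleR_sum_right
      by (intro Bochner_Integration.integrable_sum) auto
    have "dist (\<Sum>i\<in>F. LINT t:A|lborel. w t * f i t) (LINT t:A|lborel. w t * S t)
        = norm (LINT t:A|lborel. (\<Sum>i\<in>F. w t * f i t) - w t * S t)"
      unfolding sum dist_norm using int_sum int_S by (subst set_integral_diff) auto
    also have "\<dots> \<le> (LINT t:A|lborel. norm (w t) * d)"
      unfolding set_lebesgue_integral_def
    proof (rule Bochner_Integration.integral_norm_bound_integral)
      show "integrable lborel (\<lambda>t. indicat_real A t *\<^sub>R ((\<Sum>i\<in>F. w t * f i t) - w t * S t))"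
        using set_integral_diff(1)[OF int_sum int_S] by (simp add: set_integrable_def)
      show "integrable lborel (\<lambda>t. indicat_real A t *\<^sub>R (norm (w t) * d))"
        using set_integrable_mult_left[of d lborel A "\<lambda>t. norm (w t)"] int_w
        by (simp add: set_integrable_def)
      fix t :: real
      show "norm (indicat_real A t *\<^sub>R ((\<Sum>i\<in>F. w t * f i t) - w t * S t))
          \<le> indicat_real A t *\<^sub>R (norm (w t) * d)"
      proof (cases "t \<in> A")
        case True
        have "(\<Sum>i\<in>F. w t * f i t) - w t * S t = w t * ((\<Sum>i\<in>F. f i t) - S t)"
          by (simp add: sum_distrib_left right_diff_distrib)
        moreover have "norm ((\<Sum>i\<in>F. f i t) - S t) \<le> d"
          using elim(1) True by (auto simp: dist_norm intro: less_imp_le)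
        ultimately show ?thesis
          using True by (simp add: norm_mult mult_left_mono)
      qed auto
    qed
    also have "\<dots> = J * d" by (simp add: J_def)
    finally show ?case using d by simp
  qed
qed

text \<open>Raising the first Beta parameter by m + n multiplies the weight by t^(m+n), which is
  shared out to form (x t)^m (y t)^n. The Gamma prefactor is 1 / B(b1, c1 - b1).\<close>

lemma appell_term_eq:
  assumes "Re p > 0" "Re b1 > 0" "Re c1 > Re b1"
  shows "appell_F1_term p \<nu> b1 b2 b3 c1 x y (m, n) =
    Gamma c1 / (Gamma b1 * Gamma (c1 - b1)) * csqrt (2 * p / of_real pi) *
    (LINT t:{0<..<1}|lborel. beta_weight p \<nu> b1 (c1 - b1) t *
       ((pochhammer b2 m / fact m * (x * of_real t) ^ m) * (pochhammer b3 n / fact n * (y * of_real t) ^ n)))"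
proof -
  let ?w = "beta_weight p \<nu> b1 (c1 - b1)"
  define k where "k = pochhammer b2 m / fact m * x ^ m * (pochhammer b3 n / fact n * y ^ n)"
  have weight: "beta_weight p \<nu> (b1 + of_nat m + of_nat n) (c1 - b1) t = ?w t * of_real t ^ (m + n)"
    if "t \<in> {0<..<1}" for t
  proof -
    have "complex_of_real t powr (b1 + of_nat m + of_nat n - 3/2)
        = of_real t powr (b1 - 3/2) * of_real t powr of_nat (m + n)"
      unfolding powr_add[symmetric] by (simp add: algebra_simps)
    \<comment> \<open>Here t \<noteq> 0 matters: \<open>0 powr 0\<close> is 0, whereas
      \<open>0 ^ 0\<close> is 1.\<close>
    also have "complex_of_real t powr of_nat (m + n) = of_real t ^ (m + n)"
      using that by (subst powr_complexpow) auto
    finally show ?thesis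
      by (simp add: beta_weight_def mult_ac)
  qed
  have "(LINT t:{0<..<1}|lborel. ?w t *
       ((pochhammer b2 m / fact m * (x * of_real t) ^ m) * (pochhammer b3 n / fact n * (y * of_real t) ^ n)))
     = (LINT t:{0<..<1}|lborel. k * beta_weight p \<nu> (b1 + of_nat m + of_nat n) (c1 - b1) t)"
    by (intro set_lebesgue_integral_cong) (auto simp: weight k_def power_mult_distrib power_add mult_ac)
  also have "\<dots> = k * (LINT t:{0<..<1}|lborel. beta_weight p \<nu> (b1 + of_nat m + of_nat n) (c1 - b1) t)"
    by simp
  finally have *: "(LINT t:{0<..<1}|lborel. ?w t *
       ((pochhammer b2 m / fact m * (x * of_real t) ^ m) * (pochhammer b3 n / fact n * (y * of_real t) ^ n)))
     = k * (LINT t:{0<..<1}|lborel. beta_weight p \<nu> (b1 + of_nat m + of_nat n) (c1 - b1) t)" .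
  show ?thesis
    unfolding * by (simp add: appell_F1_term_def ext_Beta_eq_weight Beta_def k_def mult_ac)
qed

lemma appell_F1_has_sum:
  assumes p: "Re p > 0" "Re b1 > 0" "Re c1 > Re b1" and xy: "norm x < 1" "norm y < 1"
  shows "(appell_F1_term p \<nu> b1 b2 b3 c1 x y has_sum
    Gamma c1 / (Gamma b1 * Gamma (c1 - b1)) * csqrt (2 * p / of_real pi) *
    (LINT t:{0<..<1}|lborel. beta_weight p \<nu> b1 (c1 - b1) t * appell_kernel b2 b3 (x, y) t)) UNIV"
proof -
  let ?w = "beta_weight p \<nu> b1 (c1 - b1)"
  define f where "f = (\<lambda>(m, n) t. (pochhammer b2 m / fact m * (x * complex_of_real t) ^ m) *
      (pochhammer b3 n / fact n * (y * complex_of_real t) ^ n))"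
  \<comment> \<open>The moduli of the terms at t = 1, which dominate those at all t in
    (0,1).\<close>
  define M where "M = (\<lambda>(m, n). norm (pochhammer b2 m / fact m * x ^ m) * norm (pochhammer b3 n / fact n * y ^ n))"
  have "((\<lambda>i. LINT t:{0<..<1}|lborel. ?w t * f i t) has_sum
      (LINT t:{0<..<1}|lborel. ?w t * appell_kernel b2 b3 (x, y) t)) UNIV"
  proof (rule has_sum_weighted_integral)
    show w: "set_integrable lborel {0<..<1} ?w"
      by (rule beta_weight_integrable[OF p(1)])
    show "f i \<in> borel_measurable borel" for i
      unfolding f_def by (cases i) (simp, measurable)
    show "M summable_on UNIV"
      unfolding M_def
      by (rule has_sum_product_nat(2)[OF binomial_series_has_sum binomial_series_has_sum]; 
          intro binomial_series_norm_summable xy)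
    show "norm (f i t) \<le> M i" if "t \<in> {0<..<1}" for i t
    proof -
      have "norm z * \<bar>t\<bar> \<le> norm z" for z :: complex
        using that by (intro mult_right_le_one_le) auto
      then have "norm (z * of_real t) ^ m \<le> norm z ^ m" for z :: complex and m
        by (intro power_mono) (auto simp: norm_mult)
      then show ?thesis
        by (cases i) (auto simp: f_def M_def norm_mult norm_divide norm_power
              simp del: power_mult_distrib intro!: mult_mono divide_right_mono mult_nonneg_nonneg)
    qed
    show "((\<lambda>i. f i t) has_sum appell_kernel b2 b3 (x, y) t) UNIV" if t: "t \<in> {0<..<1}" for t
    proof -
      have less: "norm (z * of_real t) < 1" if "norm z < 1" for z :: complex
        using t that mult_strict_mono'[of "norm z" 1 t 1] by (simp add: norm_mult)
      show ?thesis
        unfolding f_def appell_kernel_def case_prod_unfold fst_conv snd_conv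
        using has_sum_product_nat(1)[OF binomial_series_has_sum binomial_series_has_sum
            binomial_series_norm_summable binomial_series_norm_summable,
            OF less less less less, OF xy xy, of b2 b3]
        by (simp add: case_prod_unfold)
    qed
    show "set_integrable lborel {0<..<1} (\<lambda>t. ?w t * appell_kernel b2 b3 (x, y) t)"
      using xy by (intro weighted_appell_kernel_integrable w) (auto intro: ball_subset_slit_plane)
  qed
  then have "((\<lambda>i. Gamma c1 / (Gamma b1 * Gamma (c1 - b1)) * csqrt (2 * p / of_real pi) *
        (LINT t:{0<..<1}|lborel. ?w t * f i t)) has_sum
      Gamma c1 / (Gamma b1 * Gamma (c1 - b1)) * csqrt (2 * p / of_real pi) *
        (LINT t:{0<..<1}|lborel. ?w t * appell_kernel b2 b3 (x, y) t)) UNIV"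
    by (rule has_sum_cmult_right)
  moreover have "Gamma c1 / (Gamma b1 * Gamma (c1 - b1)) * csqrt (2 * p / of_real pi) *
        (LINT t:{0<..<1}|lborel. ?w t * f i t) = appell_F1_term p \<nu> b1 b2 b3 c1 x y i" for i
    using appell_term_eq[OF p, of \<nu> b2 b3 x y "fst i" "snd i"] by (simp add: f_def case_prod_unfold)
  ultimately show ?thesis by simp
qed

section \<open>Holomorphy in the two parameters\<close>

text \<open>Dominated convergence is applied to the first-order remainder divided by
  \<open>norm (z - z0)\<close>. It tends to 0 pointwise by differentiability at z0, and the
  Lipschitz bound together with a and b dominates it.\<close>

lemma has_derivative_integral_dominated:
  fixes f :: "complex \<times> complex \<Rightarrow> 'b \<Rightarrow> complex" and a b :: "'b \<Rightarrow> complex"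
  assumes "r > 0"
    and int: "\<And>z. z \<in> ball z0 r \<Longrightarrow> integrable M (f z)"
    and a: "integrable M a" and b: "integrable M b"
    and deriv: "\<And>t. t \<in> space M \<Longrightarrow> ((\<lambda>z. f z t) has_derivative (\<lambda>(h, k). a t * h + b t * k)) (at z0)"
    and L: "integrable M L"
    and lip: "\<And>z t. z \<in> ball z0 r \<Longrightarrow> t \<in> space M \<Longrightarrow> norm (f z t - f z0 t) \<le> L t * norm (z - z0)"
  shows "((\<lambda>z. \<integral>t. f z t \<partial>M) has_derivative
          (\<lambda>(h, k). (\<integral>t. a t \<partial>M) * h + (\<integral>t. b t \<partial>M) * k)) (at z0)"
proof -
  define D where "D t h = a t * fst h + b t * snd h" for t and h :: "complex \<times> complex"
  define R where "R z t = (f z t - f z0 t - D t (z - z0)) /\<^sub>R norm (z - z0)" for z t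
  have int0: "integrable M (f z0)" using int \<open>r > 0\<close> by simp
  have int_D: "integrable M (\<lambda>t. D t h)" for h
    unfolding D_def using a b by simp
  have integral_D: "(\<integral>t. D t h \<partial>M) = (\<integral>t. a t \<partial>M) * fst h + (\<integral>t. b t \<partial>M) * snd h" for h
    unfolding D_def using a b by simp
  have int_R: "integrable M (R z)" if "z \<in> ball z0 r" for z
    unfolding R_def using int[OF that] int0 int_D by simp
  have integral_R: "(\<integral>t. R z t \<partial>M) =
      ((\<integral>t. f z t \<partial>M) - (\<integral>t. f z0 t \<partial>M) - (\<integral>t. D t (z - z0) \<partial>M)) /\<^sub>R norm (z - z0)"
    if "z \<in> ball z0 r" for z
    unfolding R_def using int[OF that] int0 int_D by simp
  have "((\<lambda>z. \<integral>t. R z t \<partial>M) \<longlongrightarrow> 0) (at z0)"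
    \<comment> \<open>Dominated convergence is a statement about sequences, so the limit at z0 is
      tested along arbitrary ones.\<close>
    unfolding tendsto_at_iff_sequentially comp_def
  proof (intro allI impI)
    fix X :: "nat \<Rightarrow> complex \<times> complex"
    assume X: "\<forall>i. X i \<in> UNIV - {z0}" "X \<longlonglongrightarrow> z0"
    have "eventually (\<lambda>n. X n \<in> ball z0 r) sequentially"
      using X(2) \<open>r > 0\<close> by (auto simp: tendsto_iff dist_commute)
    \<comment> \<open>The integrability and Lipschitz hypotheses hold only in the ball, so the first
      N terms are dropped.\<close>
    then obtain N where N: "\<And>n. X (n + N) \<in> ball z0 r"
      by (auto simp: eventually_sequentially) (metis le_add2)
    have "(\<lambda>n. \<integral>t. R (X (n + N)) t \<partial>M) \<longlonglongrightarrow> (\<integral>t. 0 \<partial>M)"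
    proof (rule integral_dominated_convergence[where w = "\<lambda>t. L t + norm (a t) + norm (b t)"])
      show "integrable M (\<lambda>t. L t + norm (a t) + norm (b t))"
        using L a b by simp
      show "R (X (n + N)) \<in> borel_measurable M" for n
        using int_R[OF N] by (rule borel_measurable_integrable)
      show "AE t in M. (\<lambda>n. R (X (n + N)) t) \<longlonglongrightarrow> 0"
      proof (rule AE_I2)
        fix t assume "t \<in> space M"
        from deriv[OF this] have "((\<lambda>z. R z t) \<longlongrightarrow> 0) (at z0)"
          unfolding has_derivative_def R_def D_def by (simp add: case_prod_unfold divide_inverse)
        then have "(\<lambda>n. R (X n) t) \<longlonglongrightarrow> 0"
          using X unfolding tendsto_at_iff_sequentially comp_def by blast
        then show "(\<lambda>n. R (X (n + N)) t) \<longlonglongrightarrow> 0"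
          by (rule LIMSEQ_ignore_initial_segment)
      qed
      show "AE t in M. norm (R (X (n + N)) t) \<le> L t + norm (a t) + norm (b t)" for n
      proof (rule AE_I2)
        fix t assume t: "t \<in> space M"
        define h where "h = X (n + N) - z0"
        have h: "norm h > 0" using X(1) by (simp add: h_def)
        have "norm (D t h) \<le> norm (a t) * norm (fst h) + norm (b t) * norm (snd h)"
          unfolding D_def by (metis norm_mult norm_triangle_ineq)
        also have "\<dots> \<le> norm (a t) * norm h + norm (b t) * norm h"
          by (intro add_mono mult_left_mono) (auto, (metis norm_fst_le norm_snd_le prod.collapse)+)
        finally have "norm (f (X (n + N)) t - f z0 t - D t h)
            \<le> L t * norm h + (norm (a t) * norm h + norm (b t) * norm h)"
          using lip[OF N t, of n] norm_triangle_ineq4[of "f (X (n + N)) t - f z0 t" "D t h"]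
          unfolding h_def by linarith
        then have "norm (f (X (n + N)) t - f z0 t - D t h) / norm h \<le> L t + norm (a t) + norm (b t)"
          using h by (subst pos_divide_le_eq) (simp_all add: distrib_right)
        then show "norm (R (X (n + N)) t) \<le> L t + norm (a t) + norm (b t)"
          unfolding R_def h_def[symmetric] by (simp add: divide_inverse mult.commute)
      qed
    qed simp
    then have "(\<lambda>n. \<integral>t. R (X (n + N)) t \<partial>M) \<longlonglongrightarrow> 0" by simp
    then show "(\<lambda>n. \<integral>t. R (X n) t \<partial>M) \<longlonglongrightarrow> 0"
      by (rule LIMSEQ_offset)
  qed
  moreover have "eventually (\<lambda>z. z \<in> ball z0 r) (at z0)"
    using \<open>r > 0\<close> by (intro eventually_at_in_open') auto
  then have "eventually (\<lambda>z. (\<integral>t. R z t \<partial>M) =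
      ((\<integral>t. f z t \<partial>M) - (\<integral>t. f z0 t \<partial>M) - (\<integral>t. D t (z - z0) \<partial>M)) /\<^sub>R norm (z - z0)) (at z0)"
    by (rule eventually_mono) (rule integral_R)
  ultimately have "((\<lambda>z. ((\<integral>t. f z t \<partial>M) - (\<integral>t. f z0 t \<partial>M) - (\<integral>t. D t (z - z0) \<partial>M))
      /\<^sub>R norm (z - z0)) \<longlongrightarrow> 0) (at z0)"
    by (rule Lim_transform_eventually)
  moreover have "bounded_linear (\<lambda>h. (\<integral>t. a t \<partial>M) * fst h + (\<integral>t. b t \<partial>M) * snd h)"
    by (intro bounded_linear_add bounded_linear_const_mult bounded_linear_fst bounded_linear_snd)
  ultimately show ?thesis
    unfolding has_derivative_def integral_D by (simp add: case_prod_unfold divide_inverse)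
qed

lemma appell_kernel_has_derivative:
  assumes "z \<in> slit_plane \<times> slit_plane" "0 \<le> t" "t \<le> 1"
  shows "((\<lambda>z. appell_kernel b2 b3 z t) has_derivative
    (\<lambda>(h, k). b2 * of_real t * appell_kernel (b2 + 1) b3 z t * h +
              b3 * of_real t * appell_kernel b2 (b3 + 1) z t * k)) (at z)"
proof -
  have powr: "((\<lambda>z. (1 - g z * complex_of_real t) powr (- b)) has_derivative
      (\<lambda>h. b * of_real t * (1 - g z * of_real t) powr (- (b + 1)) * g h)) (at z)"
    if g: "bounded_linear g" "g z \<in> slit_plane" for g :: "complex \<times> complex \<Rightarrow> complex" and b
  proof -
    have "((\<lambda>z. 1 - g z * complex_of_real t) has_derivative (\<lambda>h. - (g h * of_real t))) (at z)"
      by (auto intro!: derivative_eq_intros bounded_linear_imp_has_derivative[OF g(1)])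
    moreover have "((\<lambda>u. u powr (- b)) has_derivative
        (*) (- b * (1 - g z * of_real t) powr (- b - 1))) (at (1 - g z * complex_of_real t))"
      using has_field_derivative_powr[OF slit_plane_segment[OF g(2) assms(2,3)], of "- b"]
      by (simp add: has_field_derivative_def)
    ultimately have "((\<lambda>z. (1 - g z * complex_of_real t) powr (- b)) has_derivative
        (\<lambda>h. (- b * (1 - g z * of_real t) powr (- b - 1)) * (- (g h * of_real t)))) (at z)"
      by (rule has_derivative_compose)
    then show ?thesis by (simp add: mult_ac)
  qed
  show ?thesis
    unfolding appell_kernel_def case_prod_unfold
    by (rule has_derivative_eq_rhs[OF has_derivative_mult[OF
          powr[OF bounded_linear_fst] powr[OF bounded_linear_snd]]])
       (use assms(1) in \<open>auto simp: algebra_simps\<close>)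
qed

text \<open>Mean value inequality on the convex ball: the derivative consists of kernels with one
  parameter raised, bounded uniformly in t because the closed ball is compact.\<close>

lemma appell_kernel_lipschitz:
  assumes "cball z0 r \<subseteq> slit_plane \<times> slit_plane"
  obtains L where "\<And>z t. z \<in> cball z0 r \<Longrightarrow> 0 \<le> t \<Longrightarrow> t \<le> 1 \<Longrightarrow>
    norm (appell_kernel b2 b3 z t - appell_kernel b2 b3 z0 t) \<le> L * norm (z - z0)"
proof -
  obtain A where A: "A \<ge> 0" "\<And>z t. z \<in> cball z0 r \<Longrightarrow> 0 \<le> t \<Longrightarrow> t \<le> 1 \<Longrightarrow>
      norm (appell_kernel (b2 + 1) b3 z t) \<le> A"
    using appell_kernel_bounded[OF compact_cball assms] by blast
  obtain B where B: "B \<ge> 0" "\<And>z t. z \<in> cball z0 r \<Longrightarrow> 0 \<le> t \<Longrightarrow> t \<le> 1 \<Longrightarrow>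
      norm (appell_kernel b2 (b3 + 1) z t) \<le> B"
    using appell_kernel_bounded[OF compact_cball assms] by blast
  define D where "D t u = (\<lambda>(h, k). b2 * of_real t * appell_kernel (b2 + 1) b3 u t * h +
      b3 * of_real t * appell_kernel b2 (b3 + 1) u t * k)" for t :: real and u
  have deriv: "((\<lambda>z. appell_kernel b2 b3 z t) has_derivative D t u) (at u within cball z0 r)"
    if "u \<in> cball z0 r" "0 \<le> t" "t \<le> 1" for t u
    unfolding D_def
    by (rule has_derivative_at_withinI, rule appell_kernel_has_derivative) (use assms that in auto)
  have onorm: "onorm (D t u) \<le> norm b2 * A + norm b3 * B"
    if u: "u \<in> cball z0 r" and t: "0 \<le> t" "t \<le> 1" for t u
  proof (rule onorm_bound)
    show "0 \<le> norm b2 * A + norm b3 * B" using A B by simp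
    fix h :: "complex \<times> complex"
    have bound: "norm (b * of_real t * a * g) \<le> norm b * C * norm h"
      if "norm a \<le> C" "norm g \<le> norm h" for a b g :: complex and C
    proof -
      have "norm (b * of_real t * a * g) = norm b * t * norm a * norm g"
        using t by (simp add: norm_mult)
      also have "\<dots> \<le> norm b * 1 * C * norm h"
        using that t order_trans[OF norm_ge_zero that(1)] by (intro mult_mono mult_nonneg_nonneg) auto
      finally show ?thesis by simp
    qed
    have "norm (fst h) \<le> norm h" "norm (snd h) \<le> norm h"
      by (metis norm_fst_le prod.collapse) (metis norm_snd_le prod.collapse)
    then have "norm (b2 * of_real t * appell_kernel (b2 + 1) b3 u t * fst h +
        b3 * of_real t * appell_kernel b2 (b3 + 1) u t * snd h)
      \<le> norm b2 * A * norm h + norm b3 * B * norm h"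
      using A(2)[OF u t] B(2)[OF u t] by (intro norm_triangle_mono bound)
    then show "norm (D t u h) \<le> (norm b2 * A + norm b3 * B) * norm h"
      by (simp add: D_def case_prod_unfold distrib_right)
  qed
  show ?thesis
  proof (rule that)
    fix z t assume z: "z \<in> cball z0 r" and t: "0 \<le> t" "t \<le> (1::real)"
    \<comment> \<open>The sign of r is not assumed; that the ball contains z forces r \<ge>
      0.\<close>
    have "z0 \<in> cball z0 r"
      using z zero_le_dist[of z0 z] unfolding mem_cball dist_self by linarith
    from differentiable_bound[OF convex_cball deriv[OF _ t] onorm[OF _ t] z this]
    show "norm (appell_kernel b2 b3 z t - appell_kernel b2 b3 z0 t)
      \<le> (norm b2 * A + norm b3 * B) * norm (z - z0)" .
  qed
qed

lemma weighted_appell_kernel_holomorphic2: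
  assumes w: "set_integrable lborel {0<..<1} w"
  shows "holomorphic2_on (\<lambda>z. LINT t:{0<..<1}|lborel. w t * appell_kernel b2 b3 z t)
    (slit_plane \<times> slit_plane)"
  unfolding holomorphic2_on_def
proof
  fix z0 assume z0: "z0 \<in> slit_plane \<times> slit_plane"
  obtain r where r: "r > 0" "cball z0 r \<subseteq> slit_plane \<times> slit_plane"
    using z0 open_contains_cball open_Times[OF open_slit_plane open_slit_plane] by metis
  obtain L where L: "\<And>z t. z \<in> cball z0 r \<Longrightarrow> 0 \<le> t \<Longrightarrow> t \<le> 1 \<Longrightarrow>
    norm (appell_kernel b2 b3 z t - appell_kernel b2 b3 z0 t) \<le> L * norm (z - z0)"
    using appell_kernel_lipschitz[OF r(2)] by blast
  \<comment> \<open>Quantifying over all three parameters covers both partial derivatives; the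
    factor b t is merged into the weight.\<close>
  have partial: "set_integrable lborel {0<..<1} (\<lambda>t. w t * (b * of_real t * appell_kernel b2 b3 z0 t))"
    for b b2 b3
  proof -
    have "norm (b * of_real t) \<le> norm b" if "t \<in> {0<..<1}" for t :: real
      using that by (simp add: norm_mult mult_left_le)
    then have "set_integrable lborel {0<..<1} (\<lambda>t. w t * (b * of_real t))"
      by (intro set_integrable_mult_bounded[OF w, where C = "norm b"]) auto
    from weighted_appell_kernel_integrable[OF this z0, of b2 b3] show ?thesis
      by (simp add: mult.assoc)
  qed
  \<comment> \<open>The set integrals are written with the indicator inside, so that the
    differentiation lemma applies over all of \<open>lborel\<close>; off (0,1) every function
    involved is 0.\<close>
  have "((\<lambda>z. \<integral>t. indicat_real {0<..<1} t *\<^sub>R (w t * appell_kernel b2 b3 z t) \<partial>lborel) has_derivative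
      (\<lambda>(h, k).
        (\<integral>t. indicat_real {0<..<1} t *\<^sub>R (w t * (b2 * of_real t * appell_kernel (b2 + 1) b3 z0 t)) \<partial>lborel) * h +
        (\<integral>t. indicat_real {0<..<1} t *\<^sub>R (w t * (b3 * of_real t * appell_kernel b2 (b3 + 1) z0 t)) \<partial>lborel) * k))
      (at z0)"
  proof (rule has_derivative_integral_dominated[OF r(1),
        where L = "\<lambda>t. indicat_real {0<..<1} t *\<^sub>R (norm (w t) * L)"])
    show "integrable lborel (\<lambda>t. indicat_real {0<..<1} t *\<^sub>R (w t * appell_kernel b2 b3 z t))"
      if "z \<in> ball z0 r" for z
    proof -
      have "z \<in> slit_plane \<times> slit_plane"
        using that r(2) ball_subset_cball by blast
      from weighted_appell_kernel_integrable[OF w this] show ?thesis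
        by (simp only: set_integrable_def)
    qed
    show "integrable lborel (\<lambda>t. indicat_real {0<..<1} t *\<^sub>R (norm (w t) * L))"
      using set_integrable_mult_left[OF set_integrable_norm[OF w], of L]
      by (simp add: set_integrable_def)
    fix t :: real
    show "((\<lambda>z. indicat_real {0<..<1} t *\<^sub>R (w t * appell_kernel b2 b3 z t)) has_derivative
      (\<lambda>(h, k). indicat_real {0<..<1} t *\<^sub>R (w t * (b2 * of_real t * appell_kernel (b2 + 1) b3 z0 t)) * h +
        indicat_real {0<..<1} t *\<^sub>R (w t * (b3 * of_real t * appell_kernel b2 (b3 + 1) z0 t)) * k)) (at z0)"
    proof (cases "t \<in> {0<..<1}")
      case True
      then have "((\<lambda>z. w t * appell_kernel b2 b3 z t) has_derivative
        (\<lambda>h. w t * (case h of (h, k) \<Rightarrow> b2 * of_real t * appell_kernel (b2 + 1) b3 z0 t * h +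
              b3 * of_real t * appell_kernel b2 (b3 + 1) z0 t * k))) (at z0)"
        by (intro has_derivative_mult_right appell_kernel_has_derivative z0) auto
      then show ?thesis
        using True by (simp add: case_prod_unfold algebra_simps)
    qed (auto simp: case_prod_unfold)
    fix z assume z: "z \<in> ball z0 r"
    show "norm (indicat_real {0<..<1} t *\<^sub>R (w t * appell_kernel b2 b3 z t) -
          indicat_real {0<..<1} t *\<^sub>R (w t * appell_kernel b2 b3 z0 t))
        \<le> indicat_real {0<..<1} t *\<^sub>R (norm (w t) * L) * norm (z - z0)"
      using L[of z t] z
      by (cases "t \<in> {0<..<1}")
         (auto simp: norm_mult mult.assoc simp flip: right_diff_distrib intro!: mult_left_mono)
  qed (use partial in \<open>simp_all add: set_integrable_def\<close>)
  then show "\<exists>a b. ((\<lambda>z. LINT t:{0<..<1}|lborel. w t * appell_kernel b2 b3 z t) has_derivative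
      (\<lambda>(h, k). a * h + b * k)) (at z0)"
    unfolding set_lebesgue_integral_def by blast
qed

lemma holomorphic2_on_cmult:
  assumes "holomorphic2_on f S"
  shows "holomorphic2_on (\<lambda>z. c * f z) S"
  unfolding holomorphic2_on_def
proof
  fix z assume "z \<in> S"
  then obtain a b where "(f has_derivative (\<lambda>(h, k). a * h + b * k)) (at z)"
    using assms by (auto simp: holomorphic2_on_def)
  then have "((\<lambda>z. c * f z) has_derivative (\<lambda>h. c * (case h of (h, k) \<Rightarrow> a * h + b * k))) (at z)"
    by (rule has_derivative_mult_right)
  then have "((\<lambda>z. c * f z) has_derivative (\<lambda>(h, k). c * a * h + c * b * k)) (at z)"
    by (simp add: case_prod_unfold algebra_simps)
  then show "\<exists>a b. ((\<lambda>z. c * f z) has_derivative (\<lambda>(h, k). a * h + b * k)) (at z)"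
    by blast
qed

section \<open>Uniqueness of the continuation\<close>

text \<open>The inclusions x -> (x, y) and y -> (x, y) have derivatives h -> (h, 0) and k -> (0, k),
  so the chain rule leaves multiplication by a or by b, a complex derivative.\<close>

lemma holomorphic2_on_imp_holomorphic_sections:
  assumes "holomorphic2_on f (S \<times> T)"
  shows "y \<in> T \<Longrightarrow> (\<lambda>x. f (x, y)) holomorphic_on S"
    and "x \<in> S \<Longrightarrow> (\<lambda>y. f (x, y)) holomorphic_on T"
proof -
  have deriv: "\<exists>a b. (f has_derivative (\<lambda>(h, k). a * h + b * k)) (at (x, y))" if "x \<in> S" "y \<in> T" for x y
    using assms that by (auto simp: holomorphic2_on_def)
  show "(\<lambda>x. f (x, y)) holomorphic_on S" if y: "y \<in> T"
    unfolding holomorphic_on_def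
  proof
    fix x assume "x \<in> S"
    with y deriv obtain a b where *: "(f has_derivative (\<lambda>(h, k). a * h + b * k)) (at (x, y))"
      by blast
    have "((\<lambda>x. f (x, y)) has_derivative (\<lambda>h. case (h, 0) of (h, k) \<Rightarrow> a * h + b * k)) (at x)"
      by (rule has_derivative_compose[where f = "\<lambda>x. (x, y)" and g = f, OF _ *]) (auto intro!: derivative_eq_intros)
    then have "((\<lambda>x. f (x, y)) has_field_derivative a) (at x)"
      by (simp add: has_field_derivative_def)
    then show "(\<lambda>x. f (x, y)) field_differentiable at x within S"
      using field_differentiable_at_within field_differentiable_def by blast
  qed
  show "(\<lambda>y. f (x, y)) holomorphic_on T" if x: "x \<in> S"
    unfolding holomorphic_on_def
  proof
    fix y assume "y \<in> T"
    with x deriv obtain a b where *: "(f has_derivative (\<lambda>(h, k). a * h + b * k)) (at (x, y))"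
      by blast
    have "((\<lambda>y. f (x, y)) has_derivative (\<lambda>k. case (0, k) of (h, k) \<Rightarrow> a * h + b * k)) (at y)"
      by (rule has_derivative_compose[where f = "\<lambda>y. (x, y)" and g = f, OF _ *]) (auto intro!: derivative_eq_intros)
    then have "((\<lambda>y. f (x, y)) has_field_derivative b) (at y)"
      by (simp add: has_field_derivative_def)
    then show "(\<lambda>y. f (x, y)) field_differentiable at y within T"
      using field_differentiable_at_within field_differentiable_def by blast
  qed
qed

lemma holomorphic_on_slit_plane_eqI:
  assumes "f holomorphic_on slit_plane" "g holomorphic_on slit_plane"
    "\<And>x. norm x < 1 \<Longrightarrow> f x = g x" "x \<in> slit_plane"
  shows "f x = g x"
  by (rule analytic_continuation_open[of "ball 0 1" slit_plane f g])
     (use assms in \<open>auto simp: open_slit_plane connected_slit_plane intro: ball_subset_slit_plane\<close>)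

text \<open>Agreement on the bidisc spreads in x to slit plane \<times> disc for each fixed y in the
  disc; then, with x fixed in the slit plane, it spreads from the disc in y.\<close>

lemma appell_F1_continuation_unique:
  assumes "appell_F1_continuation p \<nu> b1 b2 b3 c1 F" "appell_F1_continuation p \<nu> b1 b2 b3 c1 G"
    "x \<in> slit_plane" "y \<in> slit_plane"
  shows "F (x, y) = G (x, y)"
proof -
  have hol: "holomorphic2_on F (slit_plane \<times> slit_plane)" "holomorphic2_on G (slit_plane \<times> slit_plane)"
    and disc: "\<And>x y. norm x < 1 \<Longrightarrow> norm y < 1 \<Longrightarrow> F (x, y) = G (x, y)"
    using assms(1,2) by (auto simp: appell_F1_continuation_def)
  have strip: "F (x, y) = G (x, y)" if "norm y < 1" for y
    by (rule holomorphic_on_slit_plane_eqI[of "\<lambda>x. F (x, y)" "\<lambda>x. G (x, y)"])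
       (use that assms(3) disc in \<open>auto intro: ball_subset_slit_plane
          holomorphic2_on_imp_holomorphic_sections(1)[OF hol(1)] holomorphic2_on_imp_holomorphic_sections(1)[OF hol(2)]\<close>)
  show ?thesis
    by (rule holomorphic_on_slit_plane_eqI[of "\<lambda>y. F (x, y)" "\<lambda>y. G (x, y)"])
       (use assms(3,4) strip in \<open>auto intro:
          holomorphic2_on_imp_holomorphic_sections(2)[OF hol(1)] holomorphic2_on_imp_holomorphic_sections(2)[OF hol(2)]\<close>)
qed

text \<open>Summability, existence of a continuation and integrability are asserted along with the
  formula, since infinite sums, definite descriptions and integrals are total and would otherwise
  take default values.\<close>

theorem mainTheorem1:
  fixes p b1 b2 b3 c1 :: complex and \<nu> :: real
  assumes "Re p > 0" and "\<nu> \<ge> 0" and "Re b1 > 0" and "Re c1 > Re b1"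
  shows "(\<forall>x y. norm x < 1 \<longrightarrow> norm y < 1 \<longrightarrow>
            appell_F1_term p \<nu> b1 b2 b3 c1 x y summable_on UNIV)
       \<and> (\<exists>G. appell_F1_continuation p \<nu> b1 b2 b3 c1 G)
       \<and> (\<forall>x y. x \<noteq> 1 \<longrightarrow> \<bar>Arg (1 - x)\<bar> < pi \<longrightarrow> y \<noteq> 1 \<longrightarrow> \<bar>Arg (1 - y)\<bar> < pi \<longrightarrow>
            set_integrable lborel {0<..<1} (appell_F1_integrand p \<nu> b1 b2 b3 c1 x y)
          \<and> appell_F1 p \<nu> b1 b2 b3 c1 x y =
              Gamma c1 / (Gamma b1 * Gamma (c1 - b1)) * csqrt (2 * p / of_real pi) *
              (LINT t:{0<..<1}|lborel. appell_F1_integrand p \<nu> b1 b2 b3 c1 x y t))"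
proof -
  let ?c = "Gamma c1 / (Gamma b1 * Gamma (c1 - b1)) * csqrt (2 * p / of_real pi)"
  define G where "G = (\<lambda>z. ?c *
    (LINT t:{0<..<1}|lborel. beta_weight p \<nu> b1 (c1 - b1) t * appell_kernel b2 b3 z t))"
  note w = beta_weight_integrable[OF assms(1), of \<nu> b1 "c1 - b1"]
  have sum: "(appell_F1_term p \<nu> b1 b2 b3 c1 x y has_sum G (x, y)) UNIV" if "norm x < 1" "norm y < 1" for x y
    unfolding G_def by (rule appell_F1_has_sum) (use assms that in auto)
  then have series: "appell_F1_series p \<nu> b1 b2 b3 c1 x y = G (x, y)" if "norm x < 1" "norm y < 1" for x y
    unfolding appell_F1_series_def using that by (intro infsumI) auto
  have cont: "appell_F1_continuation p \<nu> b1 b2 b3 c1 G"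
    unfolding appell_F1_continuation_def
  proof (intro conjI allI impI)
    show "holomorphic2_on G (slit_plane \<times> slit_plane)"
      unfolding G_def by (rule holomorphic2_on_cmult[OF weighted_appell_kernel_holomorphic2[OF w]])
  qed (simp add: series)
  have "appell_F1 p \<nu> b1 b2 b3 c1 x y = G (x, y)" if "x \<in> slit_plane" "y \<in> slit_plane" for x y
  proof -
    \<comment> \<open>Existence is witnessed by G itself, uniqueness by the identity theorem. This
      covers every point of the slit planes, while \<open>series\<close> settles the bidisc branch
      of \<open>appell_F1\<close>.\<close>
    have "(THE w. \<exists>F. appell_F1_continuation p \<nu> b1 b2 b3 c1 F \<and> F (x, y) = w) = G (x, y)"
    proof (rule the_equality)
      show "\<exists>F. appell_F1_continuation p \<nu> b1 b2 b3 c1 F \<and> F (x, y) = G (x, y)"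
        using cont by blast
      fix w assume "\<exists>F. appell_F1_continuation p \<nu> b1 b2 b3 c1 F \<and> F (x, y) = w"
      then obtain F where F: "appell_F1_continuation p \<nu> b1 b2 b3 c1 F" "w = F (x, y)" by blast
      show "w = G (x, y)"
        unfolding F(2) by (rule appell_F1_continuation_unique[OF F(1) cont that])
    qed
    then show ?thesis
      by (simp add: appell_F1_def series)
  qed
  moreover have "set_integrable lborel {0<..<1} (appell_F1_integrand p \<nu> b1 b2 b3 c1 x y)"
    if "x \<in> slit_plane" "y \<in> slit_plane" for x y
    using weighted_appell_kernel_integrable[OF w, of "(x, y)" b2 b3] that
    by (simp add: appell_F1_integrand_eq_weight)
  moreover have "appell_F1_term p \<nu> b1 b2 b3 c1 x y summable_on UNIV" if "norm x < 1" "norm y < 1" for x y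
    using sum[OF that] by (rule has_sum_imp_summable)
  ultimately show ?thesis
    using cont by (auto simp: slit_plane_def G_def appell_F1_integrand_eq_weight)
qed

end
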